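(* For all integers $m,n,m',n'\ge 0$, with $|M|=m+n+m'+n'$, and all $(z,w)\in\mathbb{C}^2$, $$H_{m,n,m',n'}\left(\frac{z}{\sqrt2},\frac{w}{\sqrt2}\right)=\frac{(-1)^{n+n'}}{\sqrt{2}^{\,|M|-2}}\,e^{\frac12(|z|^2+|w|^2)}\,V^{m,n}_{m',n'}(z+iw,\overline{z}+i\overline{w}).$$
   Context: For integers $m,n\ge 0$ and $\zeta\in\mathbb{C}$, $H_{m,n}(\zeta,\overline{\zeta})=(-1)^{m+n}e^{|\zeta|^2}\frac{\partial^{m+n}}{\partial\overline{\zeta}^{m}\partial\zeta^{n}}\left(e^{-|\zeta|^2}\right)$ (Wirtinger derivatives), and for $(z,w)\in\mathbb{C}^2$, $H_{m,n,m',n'}(z,w)=H_{m,n}(z+iw,\overline{z}-i\overline{w})\,H_{m',n'}(\overline{z}+i\overline{w},z-iw)$. The real Hermite functions are $h^{real}_n(x)=(-1)^ne^{x^2/2}\frac{d^n}{dx^n}(e^{-x^2})$, $x\in\mathbb{R}$, and $(h^{real}_m\otimes h^{real}_{m'})(t,t')=h^{real}_m(t)h^{real}_{m'}(t')$. The two-dimensional Fourier-Wigner transform of $f,g\in L^2(\mathbb{R}^2)$ is $$\mathcal{V}_2(f,g)(p,q)=\frac{1}{2\pi}\int_{\mathbb{R}^2}e^{i\langle y,q\rangle}f\left(y+\frac p2\right)\overline{g\left(y-\frac p2\right)}\,dy,\qquad p,q\in\mathbb{R}^2,$$ and $V^{m,n}_{m',n'}=\mathcal{V}_2(h^{real}_m\otimes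 h^{real}_{m'},h^{real}_n\otimes h^{real}_{n'})$, viewed as a function of two complex variables by $V^{m,n}_{m',n'}(\zeta_1,\zeta_2)=V^{m,n}_{m',n'}\big((\mathrm{Re}\,\zeta_1,\mathrm{Re}\,\zeta_2),(\mathrm{Im}\,\zeta_1,\mathrm{Im}\,\zeta_2)\big)$. *)

theory Defs
  imports "HOL-Analysis.Analysis"
begin

definition wirtinger :: "(complex \<Rightarrow> complex) \<Rightarrow> complex \<Rightarrow> complex" where
  "wirtinger f \<zeta> =
     (vector_derivative (\<lambda>t::real. f (\<zeta> + of_real t)) (at 0)
      - \<i> * vector_derivative (\<lambda>t::real. f (\<zeta> + \<i> * of_real t)) (at 0)) / 2"

definition wirtinger_bar :: "(complex \<Rightarrow> complex) \<Rightarrow> complex \<Rightarrow> complex" where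
  "wirtinger_bar f \<zeta> =
     (vector_derivative (\<lambda>t::real. f (\<zeta> + of_real t)) (at 0)
      + \<i> * vector_derivative (\<lambda>t::real. f (\<zeta> + \<i> * of_real t)) (at 0)) / 2"

(* The second argument in the notation H_{m,n}(\<zeta>, cnj \<zeta>) is always the conjugate of
   the first, so it is not a separate parameter here. *)
definition complex_hermite :: "nat \<Rightarrow> nat \<Rightarrow> complex \<Rightarrow> complex" where
  "complex_hermite m n \<zeta> =
     (-1) ^ (m + n) * exp (of_real ((cmod \<zeta>)\<^sup>2))
       * (wirtinger_bar ^^ m) ((wirtinger ^^ n) (\<lambda>\<xi>. exp (- of_real ((cmod \<xi>)\<^sup>2)))) \<zeta>"

(* cnj (z + \<i> * w) = cnj z - \<i> * cnj w  and  cnj (cnj z + \<i> * cnj w) = z - \<i> * w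
   are the suppressed conjugate arguments of the two factors. *)
definition complex_hermite2 ::
  "nat \<Rightarrow> nat \<Rightarrow> nat \<Rightarrow> nat \<Rightarrow> complex \<Rightarrow> complex \<Rightarrow> complex" where
  "complex_hermite2 m n m' n' z w =
     complex_hermite m n (z + \<i> * w) * complex_hermite m' n' (cnj z + \<i> * cnj w)"

(* The weights are exp (x^2 / 2) outside and exp (- x^2) inside the derivative, so these are
   the Hermite functions, not the Hermite polynomials. *)
definition real_hermite :: "nat \<Rightarrow> real \<Rightarrow> real" where
  "real_hermite n x =
     (-1) ^ n * exp (x\<^sup>2 / 2) * (deriv ^^ n) (\<lambda>t. exp (- (t\<^sup>2))) x"

definition tensor :: "(real \<Rightarrow> real) \<Rightarrow> (real \<Rightarrow> real) \<Rightarrow> real \<times> real \<Rightarrow> complex" where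
  "tensor f g = (\<lambda>(t, t'). of_real (f t * g t'))"

(* For square-integrable f and g the integrand is integrable; outside that domain the
   value carries no meaning. *)
definition fourier_wigner2 ::
  "(real \<times> real \<Rightarrow> complex) \<Rightarrow> (real \<times> real \<Rightarrow> complex)
     \<Rightarrow> real \<times> real \<Rightarrow> real \<times> real \<Rightarrow> complex" where
  "fourier_wigner2 f g p q =
     1 / (2 * of_real pi)
       * (LINT y|lebesgue. exp (\<i> * of_real (y \<bullet> q))
            * f (y + (1/2) *\<^sub>R p) * cnj (g (y - (1/2) *\<^sub>R p)))"

definition hermite_wigner ::
  "nat \<Rightarrow> nat \<Rightarrow> nat \<Rightarrow> nat \<Rightarrow> complex \<Rightarrow> complex \<Rightarrow> complex" where
  "hermite_wigner m n m' n' \<zeta>1 \<zeta>2 =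
     fourier_wigner2
       (tensor (real_hermite m) (real_hermite m'))
       (tensor (real_hermite n) (real_hermite n'))
       (Re \<zeta>1, Re \<zeta>2) (Im \<zeta>1, Im \<zeta>2)"

end

theory Submission
  imports Defs "HOL-Probability.Probability" "HOL-Real_Asymp.Real_Asymp"
begin

text \<open>
  Both sides factorise: the Fourier-Wigner transform of a tensor product splits by Fubini into two
  one-dimensional transforms, and \<open>|z + iw|\<^sup>2 + |cnj z + i cnj w|\<^sup>2 = 2(|z|\<^sup>2 + |w|\<^sup>2)\<close>.
  It remains to match \<open>H m n (\<zeta> / sqrt 2)\<close> with the one-dimensional transform \<open>W m n\<close> at
  \<open>\<zeta> = p + iq\<close>. The former satisfies \<open>H (m + 1) n = \<zeta> H m n - n H m (n - 1)\<close> with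
  \<open>H 0 n = (cnj \<zeta>) ^ n\<close>; integrating by parts against \<open>exp (iqy - y\<^sup>2)\<close> gives
  \<open>W (m + 1) n = \<zeta> W m n + 2 n W m (n - 1)\<close> and \<open>W 0 (n + 1) = - cnj \<zeta> W 0 n\<close>,
  which is the same recursion up to the scaling factor of the theorem.
\<close>

section \<open>Hermite polynomials and real Hermite functions\<close>

text \<open>These are the physicists' Hermite polynomials. The coefficient type is generic because
  they occur both over the reals, in \<open>real_hermite\<close>, and over the complex numbers,
  under the Fourier integral. At \<open>n = 0\<close> the factor \<open>2 * n\<close> makes the
  truncated index harmless.\<close>

fun hermite_poly :: "nat \<Rightarrow> 'a::idom poly" where
  "hermite_poly 0 = 1"
| "hermite_poly (Suc n) = [:0, 2:] * hermite_poly n - smult (of_nat (2 * n)) (hermite_poly (n - 1))"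

text \<open>Differentiating the three-term recursion brings in the derivatives at the two preceding
  indices, hence strong induction; the recursion then reassembles the terms.\<close>

lemma pderiv_hermite_poly:
  "pderiv (hermite_poly n :: 'a::idom poly) = smult (of_nat (2 * n)) (hermite_poly (n - 1))"
proof (induction n rule: less_induct)
  case (less n)
  show ?case
  proof (cases n)
    case (Suc k)
    have IH: "pderiv (hermite_poly k :: 'a poly) = smult (of_nat (2 * k)) (hermite_poly (k - 1))"
      using less Suc by simp
    show ?thesis
    proof (cases k)
      case (Suc l)
      have IH': "pderiv (hermite_poly l :: 'a poly) = smult (of_nat (2 * l)) (hermite_poly (l - 1))"
        using less \<open>n = Suc k\<close> Suc by simp
      have *: "[:0, 2:] * hermite_poly l - smult (of_nat (2 * l)) (hermite_poly (l - 1)) = (hermite_poly k :: 'a poly)"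
        using Suc by simp
      have "pderiv (hermite_poly n :: 'a poly) =
          [:0, 2:] * pderiv (hermite_poly k) + smult 2 (hermite_poly k)
            - smult (of_nat (2 * k)) (pderiv (hermite_poly (k - 1)))"
        using \<open>n = Suc k\<close> by (simp add: pderiv_mult pderiv_diff pderiv_smult pderiv_pCons algebra_simps)
      also have "\<dots> = smult (of_nat (2 * k)) ([:0, 2:] * hermite_poly l - smult (of_nat (2 * l)) (hermite_poly (l - 1)))
          + smult 2 (hermite_poly k)"
        using IH IH' Suc by (simp add: smult_diff_right algebra_simps)
      also have "\<dots> = smult (of_nat (2 * n)) (hermite_poly (n - 1))"
        unfolding * using \<open>n = Suc k\<close> by (simp flip: smult_add_left add: algebra_simps)
      finally show ?thesis .
    qed (use \<open>n = Suc k\<close> in \<open>simp add: pderiv_pCons\<close>)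
  qed simp
qed

text \<open>In this form the recursion is the product rule for a polynomial times
  \<open>exp (- x^2)\<close>, up to sign.\<close>

lemma hermite_poly_Suc_pderiv: "hermite_poly (Suc n) = [:0, 2:] * hermite_poly n - pderiv (hermite_poly n)"
  by (simp add: pderiv_hermite_poly)

lemma poly_hermite_poly_of_real:
  "poly (hermite_poly n) (of_real x :: complex) = of_real (poly (hermite_poly n) x)"
  by (induction n rule: hermite_poly.induct) auto

lemma deriv_funpow_gaussian:
  "(deriv ^^ n) (\<lambda>t. exp (- (t\<^sup>2))) = (\<lambda>x::real. (-1) ^ n * poly (hermite_poly n) x * exp (- (x\<^sup>2)))"
proof (induction n)
  case (Suc n)
  have "((\<lambda>x::real. (-1) ^ n * poly (hermite_poly n) x * exp (- (x\<^sup>2))) has_real_derivative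
      (-1) ^ Suc n * poly (hermite_poly (Suc n)) x * exp (- (x\<^sup>2))) (at x)" for x
    unfolding hermite_poly_Suc_pderiv
    by (auto intro!: derivative_eq_intros poly_DERIV simp: algebra_simps)
  then show ?case
    using Suc by (auto intro!: ext DERIV_imp_deriv)
qed simp

lemma real_hermite_eq: "real_hermite n x = poly (hermite_poly n) x * exp (- (x\<^sup>2 / 2))"
proof -
  have "exp (x\<^sup>2 / 2) * exp (- (x\<^sup>2)) = exp (- (x\<^sup>2 / 2))"
    by (simp flip: exp_add)
  moreover have "(-1) ^ n * (-1) ^ n = (1::real)"
    by (simp flip: power_mult_distrib)
  moreover have "real_hermite n x =
      ((-1) ^ n * (-1) ^ n) * poly (hermite_poly n) x * (exp (x\<^sup>2 / 2) * exp (- (x\<^sup>2)))"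
    unfolding real_hermite_def deriv_funpow_gaussian by (simp only: mult_ac)
  ultimately show ?thesis
    by simp
qed

section \<open>Fourier integrals of polynomials against a Gaussian\<close>

definition gauss_wave :: "real \<Rightarrow> real \<Rightarrow> complex" where
  "gauss_wave q y = exp (\<i> * of_real (y * q) - (of_real y)\<^sup>2)"

lemma norm_gauss_wave: "norm (gauss_wave q y) = exp (- (y\<^sup>2))"
  by (simp add: gauss_wave_def norm_exp_eq_Re power2_eq_square)

lemma continuous_gauss_wave [continuous_intros]: "continuous_on S (gauss_wave q)"
  unfolding gauss_wave_def by (intro continuous_intros)

lemma continuous_poly_of_real [continuous_intros]:
  "continuous_on S (\<lambda>y. poly p (of_real y :: complex))"
  by (intro continuous_on_poly continuous_intros)

text \<open>The function extends to an entire function, whose complex derivative restricts to the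
  real axis.\<close>

lemma has_vector_derivative_gauss_wave:
  "((\<lambda>y. gauss_wave q y * poly p (of_real y)) has_vector_derivative
     gauss_wave q y * poly ([:\<i> * of_real q, -2:] * p + pderiv p) (of_real y)) (at y)"
proof -
  have "((\<lambda>z. exp (\<i> * z * of_real q - z\<^sup>2) * poly p z) has_field_derivative
     exp (\<i> * z * of_real q - z\<^sup>2) * poly ([:\<i> * of_real q, -2:] * p + pderiv p) z) (at z)" for z
    by (auto intro!: derivative_eq_intros poly_DERIV simp: algebra_simps)
  from has_vector_derivative_real_field[OF this[of "of_real y"]]
  show ?thesis by (simp add: gauss_wave_def mult.assoc)
qed

lemma integrable_power_gaussian: "integrable lborel (\<lambda>y::real. y ^ k * exp (- (y\<^sup>2)))"
proof -
  \<comment> \<open>Variance 1/2 turns the normal density into \<open>exp (- y^2) / sqrt pi\<close>,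
    so the claim is about its moments.\<close>
  have "integrable lborel (\<lambda>y. sqrt pi * (normal_density 0 (1 / sqrt 2) y * (y - 0) ^ k))"
    by (intro integrable_mult_right integrable_normal_moment) simp
  then show ?thesis
    by (simp add: normal_density_def power_divide real_sqrt_divide field_simps)
qed

text \<open>Induction on the polynomial, strengthened by an arbitrary power of \<open>y\<close>:
  peeling off a coefficient leaves a monomial and raises that power by one.\<close>

lemma integrable_gauss_wave: "integrable lborel (\<lambda>y. gauss_wave q y * poly p (of_real y))"
proof -
  have "integrable lborel (\<lambda>y. of_real y ^ k * (gauss_wave q y * poly p (of_real y)))" for k
  proof (induction p arbitrary: k)
    case (pCons a p)
    have "integrable lborel (\<lambda>y. of_real y ^ k * gauss_wave q y)"
    proof (rule Bochner_Integration.integrable_bound[OF integrable_power_gaussian[of k]])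
      show "(\<lambda>y. complex_of_real y ^ k * gauss_wave q y) \<in> borel_measurable lborel"
        by (simp, intro borel_measurable_continuous_onI continuous_intros)
    qed (simp add: norm_mult norm_power norm_gauss_wave abs_mult power_abs)
    then have "integrable lborel (\<lambda>y. a * (of_real y ^ k * gauss_wave q y)
        + of_real y ^ Suc k * (gauss_wave q y * poly p (of_real y)))"
      by (intro Bochner_Integration.integrable_add integrable_mult_right pCons)
    then show ?case by (simp add: algebra_simps)
  qed simp
  from this[of 0] show ?thesis by simp
qed

text \<open>The same strengthened induction; this supplies the vanishing boundary terms for
  integration by parts.\<close>

lemma tendsto_gauss_wave:
  assumes "F = at_top \<or> F = at_bot"
  shows "((\<lambda>y. gauss_wave q y * poly p (of_real y)) \<longlongrightarrow> 0) F"
proof -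
  have "((\<lambda>y. of_real y ^ k * (gauss_wave q y * poly p (of_real y))) \<longlongrightarrow> 0) F" for k
  proof (induction p arbitrary: k)
    case (pCons a p)
    have "((\<lambda>y::real. y ^ k * exp (- (y\<^sup>2))) \<longlongrightarrow> 0) at_top" for k
      by real_asymp
    moreover have "((\<lambda>y::real. y ^ k * exp (- (y\<^sup>2))) \<longlongrightarrow> 0) at_bot" for k
      by real_asymp
    ultimately have "((\<lambda>y::real. y ^ k * exp (- (y\<^sup>2))) \<longlongrightarrow> 0) F"
      using assms by auto
    then have "((\<lambda>y. norm (of_real y ^ k * gauss_wave q y)) \<longlongrightarrow> 0) F"
      by (auto dest: tendsto_rabs_zero simp: norm_mult norm_power norm_gauss_wave abs_mult power_abs)
    then have "((\<lambda>y. a * (of_real y ^ k * gauss_wave q y)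
        + of_real y ^ Suc k * (gauss_wave q y * poly p (of_real y))) \<longlongrightarrow> a * 0 + 0) F"
      by (intro tendsto_add tendsto_mult tendsto_const pCons) (rule tendsto_norm_zero_cancel)
    then show ?case by (simp add: algebra_simps)
  qed simp
  from this[of 0] show ?thesis by simp
qed

definition gauss_fourier :: "real \<Rightarrow> complex poly \<Rightarrow> complex" where
  "gauss_fourier q p = (LINT y|lborel. gauss_wave q y * poly p (of_real y))"

lemma gauss_fourier_add: "gauss_fourier q (p + r) = gauss_fourier q p + gauss_fourier q r"
  unfolding gauss_fourier_def poly_add distrib_left
  by (intro Bochner_Integration.integral_add integrable_gauss_wave)

lemma gauss_fourier_smult: "gauss_fourier q (smult c p) = c * gauss_fourier q p"
  unfolding gauss_fourier_def by (simp add: mult.left_commute[of _ c])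

text \<open>The integrand is the derivative of \<open>gauss_wave q y * poly p y\<close>, which
  vanishes at both infinities.\<close>

lemma gauss_fourier_parts: "gauss_fourier q ([:\<i> * of_real q, -2:] * p + pderiv p) = 0"
proof -
  let ?r = "[:\<i> * of_real q, -2:] * p + pderiv p"
  have "(LBINT y=-\<infinity>..\<infinity>. gauss_wave q y * poly ?r (of_real y)) = 0 - 0"
  proof (rule interval_integral_FTC_integrable)
    show "isCont (\<lambda>y. gauss_wave q y * poly ?r (of_real y)) x" for x
      using continuous_on_eq_continuous_at[of UNIV "\<lambda>y. gauss_wave q y * poly ?r (of_real y)"]
      by (simp add: continuous_on_mult continuous_gauss_wave continuous_poly_of_real del: poly_add poly_mult)
    show "set_integrable lborel (einterval (-\<infinity>) \<infinity>) (\<lambda>y. gauss_wave q y * poly ?r (of_real y))"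
      using integrable_gauss_wave[of q ?r] by (simp add: set_integrable_def)
  qed (use has_vector_derivative_gauss_wave tendsto_gauss_wave in
        \<open>auto simp: ereal_tendsto_simps simp del: poly_add poly_mult\<close>)
  then show ?thesis
    by (simp add: gauss_fourier_def interval_lebesgue_integral_def set_lebesgue_integral_def)
qed

text \<open>The substitution \<open>y = x / sqrt 2\<close> reduces this to the characteristic
  function of the standard normal distribution at \<open>q / sqrt 2\<close>.\<close>

lemma gauss_fourier_1: "gauss_fourier q 1 = of_real (sqrt pi * exp (- (q\<^sup>2 / 4)))"
proof -
  have "of_real (exp (- ((q / sqrt 2)\<^sup>2) / 2)) = char std_normal_distribution (q / sqrt 2)"
    by (simp add: char_std_normal_distribution)
  also have "\<dots> = (LINT x|lborel. std_normal_density x *\<^sub>R iexp (q / sqrt 2 * x))"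
    unfolding char_def by (subst integral_density) auto
  also have "\<dots> = (LINT x|lborel. gauss_wave q (x / sqrt 2)) / of_real (sqrt (2 * pi))"
    unfolding Bochner_Integration.integral_divide_zero[symmetric]
  proof (intro Bochner_Integration.integral_cong refl)
    fix x :: real
    have "gauss_wave q (x / sqrt 2) = exp (- of_real (x\<^sup>2 / 2)) * iexp (q / sqrt 2 * x)"
      unfolding exp_add[symmetric] gauss_wave_def of_real_power[symmetric]
      by (simp add: power_divide mult_ac)
    then show "std_normal_density x *\<^sub>R iexp (q / sqrt 2 * x) =
        gauss_wave q (x / sqrt 2) / of_real (sqrt (2 * pi))"
      by (simp add: std_normal_density_def scaleR_conv_of_real flip: exp_of_real)
  qed
  also have "(LINT x|lborel. gauss_wave q (x / sqrt 2)) = sqrt 2 *\<^sub>R (LINT x|lborel. gauss_wave q x)"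
    by (subst lborel_integral_real_affine[where c = "1 / sqrt 2" and t = 0 and f = "gauss_wave q"]) simp_all
  finally show ?thesis
    by (simp add: gauss_fourier_def real_sqrt_mult scaleR_conv_of_real field_simps power_divide)
qed

section \<open>The one-dimensional transform and its recursions\<close>

text \<open>This is the one-dimensional Fourier-Wigner transform of two Hermite functions without
  its normalising constant. The factor in front is what remains of the two shifted Gaussians once
  \<open>exp (- y^2)\<close> is split off.\<close>

definition hermite_wigner1 :: "nat \<Rightarrow> nat \<Rightarrow> real \<Rightarrow> real \<Rightarrow> complex" where
  "hermite_wigner1 m n p q = of_real (exp (- (p\<^sup>2 / 4))) *
     gauss_fourier q (pcompose (hermite_poly m) [:of_real (p / 2), 1:] *
                      pcompose (hermite_poly n) [:- of_real (p / 2), 1:])"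

lemma pcompose_hermite_poly_Suc:
  "pcompose (hermite_poly (Suc n)) [:c, 1:] =
     [:2 * c, 2:] * pcompose (hermite_poly n) [:c, 1:] - pderiv (pcompose (hermite_poly n) [:c, 1:])"
  unfolding hermite_poly_Suc_pderiv
  by (simp add: pcompose_diff pcompose_mult pderiv_pcompose pcompose_pCons pcompose_smult pderiv_pCons smult_add_right algebra_simps)

lemma pderiv_pcompose_hermite_poly:
  "pderiv (pcompose (hermite_poly n) [:c, 1:]) =
     smult (of_nat (2 * n)) (pcompose (hermite_poly (n - 1)) [:c, 1:])"
  by (simp add: pderiv_pcompose pderiv_hermite_poly pcompose_smult pderiv_pCons)

text \<open>Adding the vanishing integral from \<open>gauss_fourier_parts\<close> cancels the term
  \<open>2 * y\<close> and the derivative of the first factor. What survives is the multiplier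
  \<open>p + iq\<close> and the derivative of the second factor, which lowers
  \<open>n\<close>.\<close>

lemma hermite_wigner1_Suc:
  "hermite_wigner1 (Suc m) n p q = (of_real p + \<i> * of_real q) * hermite_wigner1 m n p q
     + 2 * of_nat n * hermite_wigner1 m (n - 1) p q"
proof -
  define A where "A = pcompose (hermite_poly m) [:complex_of_real (p / 2), 1:]"
  define B where "B k = pcompose (hermite_poly k) [:- complex_of_real (p / 2), 1:]" for k
  let ?S = "pcompose (hermite_poly (Suc m)) [:complex_of_real (p / 2), 1:]"
  have S: "?S = [:of_real p, 2:] * A - pderiv A"
    by (simp only: pcompose_hermite_poly_Suc A_def) simp
  have "gauss_fourier q (?S * B n) =
      gauss_fourier q (?S * B n) + gauss_fourier q ([:\<i> * of_real q, -2:] * (A * B n) + pderiv (A * B n))"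
    by (simp only: gauss_fourier_parts add_0_right)
  also have "\<dots> = gauss_fourier q (?S * B n + ([:\<i> * of_real q, -2:] * (A * B n) + pderiv (A * B n)))"
    by (rule gauss_fourier_add[symmetric])
  also have "?S * B n + ([:\<i> * of_real q, -2:] * (A * B n) + pderiv (A * B n)) =
      ([:of_real p, 2:] + [:\<i> * of_real q, -2:]) * (A * B n) + A * pderiv (B n)"
    by (simp only: S pderiv_mult) (simp only: algebra_simps)
  also have "\<dots> = smult (of_real p + \<i> * of_real q) (A * B n) + smult (of_nat (2 * n)) (A * B (n - 1))"
    by (simp add: B_def pderiv_pcompose_hermite_poly)
  finally have "gauss_fourier q (?S * B n) = (of_real p + \<i> * of_real q) * gauss_fourier q (A * B n)
      + of_nat (2 * n) * gauss_fourier q (A * B (n - 1))"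
    by (simp only: gauss_fourier_add gauss_fourier_smult)
  then show ?thesis
    unfolding hermite_wigner1_def A_def[symmetric] B_def[symmetric]
    by (simp add: algebra_simps)
qed

text \<open>The same cancellation with first factor 1; the opposite shift \<open>- p / 2\<close>
  gives the multiplier \<open>- p + iq\<close>.\<close>

lemma hermite_wigner1_0_Suc:
  "hermite_wigner1 0 (Suc n) p q = - cnj (Complex p q) * hermite_wigner1 0 n p q"
proof -
  define B where "B = pcompose (hermite_poly n) [:- complex_of_real (p / 2), 1:]"
  let ?S = "pcompose (hermite_poly (Suc n)) [:- complex_of_real (p / 2), 1:]"
  have S: "?S = [:- of_real p, 2:] * B - pderiv B"
    by (simp only: pcompose_hermite_poly_Suc B_def) simp
  have "gauss_fourier q ?S = gauss_fourier q ?S + gauss_fourier q ([:\<i> * of_real q, -2:] * B + pderiv B)"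
    by (simp only: gauss_fourier_parts add_0_right)
  also have "\<dots> = gauss_fourier q (?S + ([:\<i> * of_real q, -2:] * B + pderiv B))"
    by (rule gauss_fourier_add[symmetric])
  also have "?S + ([:\<i> * of_real q, -2:] * B + pderiv B) =
      ([:- of_real p, 2:] + [:\<i> * of_real q, -2:]) * B"
    by (simp only: S) (simp only: algebra_simps)
  also have "\<dots> = smult (- cnj (Complex p q)) B"
    by (simp add: Complex_eq)
  finally have "gauss_fourier q ?S = - cnj (Complex p q) * gauss_fourier q B"
    by (simp only: gauss_fourier_smult)
  then show ?thesis
    by (simp add: hermite_wigner1_def B_def pcompose_1 del: hermite_poly.simps(2))
qed

section \<open>Complex Hermite polynomials by Wirtinger calculus\<close>

text \<open>For \<open>n = 0\<close> the truncated \<open>n - 1\<close> is harmless because of the factor \<open>n\<close>.\<close>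

fun ito_hermite :: "nat \<Rightarrow> nat \<Rightarrow> complex \<Rightarrow> complex" where
  "ito_hermite 0 n z = cnj z ^ n"
| "ito_hermite (Suc m) n z = z * ito_hermite m n z - of_nat n * ito_hermite m (n - 1) z"

text \<open>A real-linear derivative in the form \<open>d * a + cnj d * b\<close> displays both
  Wirtinger derivatives at once: the directions 1 and i yield \<open>a + b\<close> and
  \<open>i * (a - b)\<close>.\<close>

lemma wirtinger_eqs:
  assumes "(f has_derivative (\<lambda>d. d * a + cnj d * b)) (at z)"
  shows wirtinger_eq: "wirtinger f z = a" and wirtinger_bar_eq: "wirtinger_bar f z = b"
proof -
  have *: "vector_derivative (\<lambda>t::real. f (z + c * of_real t)) (at 0) = c * a + cnj c * b" for c
  proof (rule vector_derivative_at)
    have "((\<lambda>t::real. z + c * of_real t) has_derivative (\<lambda>t. c * of_real t)) (at 0)"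
      by (auto intro!: derivative_eq_intros)
    then have "((\<lambda>t::real. f (z + c * of_real t)) has_derivative
        (\<lambda>t. (c * of_real t) * a + cnj (c * of_real t) * b)) (at 0)"
      by (rule has_derivative_compose) (use assms in simp)
    then show "((\<lambda>t::real. f (z + c * of_real t)) has_vector_derivative c * a + cnj c * b) (at 0)"
      by (simp add: has_vector_derivative_def scaleR_conv_of_real algebra_simps)
  qed
  have "vector_derivative (\<lambda>t::real. f (z + of_real t)) (at 0) = a + b"
    using *[of 1] by simp
  then show "wirtinger f z = a" "wirtinger_bar f z = b"
    unfolding wirtinger_def wirtinger_bar_def *[of \<i>] by (simp_all add: algebra_simps)
qed

lemma has_derivative_ito_hermite:
  "(ito_hermite m n has_derivative
     (\<lambda>d. d * (of_nat m * ito_hermite (m - 1) n z) + cnj d * (of_nat n * ito_hermite m (n - 1) z))) (at z)"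
proof (induction m arbitrary: n)
  case 0
  show ?case
    unfolding ito_hermite.simps[abs_def]
    by (auto intro!: derivative_eq_intros has_derivative_cnj simp: mult_ac)
next
  case (Suc m)
  \<comment> \<open>The recursion for index \<open>m\<close> needs \<open>m > 0\<close>; multiplying
    by \<open>m\<close> keeps it true at \<open>m = 0\<close>.\<close>
  have *: "of_nat m * ito_hermite m n z = of_nat m * (z * ito_hermite (m - 1) n z - of_nat n * ito_hermite (m - 1) (n - 1) z)"
    for n by (cases m) auto
  have "((\<lambda>z. z * ito_hermite m n z - of_nat n * ito_hermite m (n - 1) z) has_derivative
     (\<lambda>d. (z * (d * (of_nat m * ito_hermite (m - 1) n z) + cnj d * (of_nat n * ito_hermite m (n - 1) z))
            + d * ito_hermite m n z)
        - of_nat n * (d * (of_nat m * ito_hermite (m - 1) (n - 1) z)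
            + cnj d * (of_nat (n - 1) * ito_hermite m (n - 1 - 1) z)))) (at z)"
    by (intro has_derivative_diff has_derivative_mult has_derivative_mult_right Suc has_derivative_ident)
  moreover have "d * (of_nat (Suc m) * ito_hermite m n z) = d * ito_hermite m n z
      + d * (of_nat m * (z * ito_hermite (m - 1) n z - of_nat n * ito_hermite (m - 1) (n - 1) z))" for d
    unfolding *[symmetric] by (simp add: algebra_simps)
  ultimately show ?case
    unfolding ito_hermite.simps[abs_def] diff_Suc_1
    by (elim has_derivative_eq_rhs) (simp add: fun_eq_iff algebra_simps)
qed

lemma has_derivative_gaussian:
  "((\<lambda>z. exp (- of_real ((cmod z)\<^sup>2))) has_derivative
     (\<lambda>d. d * (- cnj z * exp (- of_real ((cmod z)\<^sup>2))) + cnj d * (- z * exp (- of_real ((cmod z)\<^sup>2))))) (at z)"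
proof -
  have "((\<lambda>z. - (z * cnj z)) has_derivative (\<lambda>d. - (z * cnj d + d * cnj z))) (at z)"
    by (intro has_derivative_minus has_derivative_mult has_derivative_cnj has_derivative_ident)
  from has_derivative_compose[OF this has_field_derivative_imp_has_derivative[OF DERIV_exp]]
  show ?thesis
    unfolding complex_norm_square by (simp add: algebra_simps)
qed

text \<open>The coefficient of \<open>cnj d\<close> collapses to index \<open>Suc m\<close> by the
  defining recursion. For \<open>m = 0\<close> that of \<open>d\<close> is multiplication by
  \<open>- cnj z\<close>. The constant \<open>c\<close> carries the signs accumulated under
  iteration.\<close>

lemma has_derivative_ito_hermite_gaussian:
  fixes c z :: complex
  defines "E \<equiv> \<lambda>z. exp (- of_real ((cmod z)\<^sup>2)) :: complex"
  shows "((\<lambda>z. c * (ito_hermite m n z * E z)) has_derivative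
     (\<lambda>d. d * (c * ((of_nat m * ito_hermite (m - 1) n z - cnj z * ito_hermite m n z) * E z))
        + cnj d * (- c * (ito_hermite (Suc m) n z * E z)))) (at z)"
proof -
  have "((\<lambda>z. c * (ito_hermite m n z * E z)) has_derivative
     (\<lambda>d. c * (ito_hermite m n z * (d * (- cnj z * E z) + cnj d * (- z * E z))
          + (d * (of_nat m * ito_hermite (m - 1) n z) + cnj d * (of_nat n * ito_hermite m (n - 1) z)) * E z))) (at z)"
    unfolding E_def
    by (intro has_derivative_mult_right has_derivative_mult has_derivative_ito_hermite has_derivative_gaussian)
  then show ?thesis
    by (rule has_derivative_eq_rhs) (simp add: fun_eq_iff algebra_simps)
qed

lemma wirtinger_funpow_gaussian:
  "(wirtinger ^^ n) (\<lambda>z. exp (- of_real ((cmod z)\<^sup>2))) =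
     (\<lambda>z. (-1) ^ n * (ito_hermite 0 n z * exp (- of_real ((cmod z)\<^sup>2))))"
proof (induction n)
  case (Suc n)
  show ?case
    unfolding funpow.simps o_def Suc
    by (rule ext) (simp only: wirtinger_eq[OF has_derivative_ito_hermite_gaussian], simp)
qed simp

lemma wirtinger_bar_funpow_gaussian:
  "(wirtinger_bar ^^ m) (\<lambda>z. c * (ito_hermite 0 n z * exp (- of_real ((cmod z)\<^sup>2)))) =
     (\<lambda>z. (-1) ^ m * c * (ito_hermite m n z * exp (- of_real ((cmod z)\<^sup>2))))"
proof (induction m)
  case (Suc m)
  show ?case
    unfolding funpow.simps o_def Suc
    by (rule ext) (simp only: wirtinger_bar_eq[OF has_derivative_ito_hermite_gaussian], simp)
qed simp

lemma complex_hermite_eq: "complex_hermite m n z = ito_hermite m n z"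
proof -
  have "exp (of_real ((cmod z)\<^sup>2)) * exp (- of_real ((cmod z)\<^sup>2)) = (1 :: complex)"
    by (simp flip: exp_add)
  moreover have "(-1) ^ (m + n) * ((-1) ^ m * (-1) ^ n) = (1 :: complex)"
    by (simp flip: power_add power_mult_distrib)
  moreover have "complex_hermite m n z = ((-1) ^ (m + n) * ((-1) ^ m * (-1) ^ n)) * ito_hermite m n z
      * (exp (of_real ((cmod z)\<^sup>2)) * exp (- of_real ((cmod z)\<^sup>2)))"
    unfolding complex_hermite_def wirtinger_funpow_gaussian wirtinger_bar_funpow_gaussian
    by (simp only: mult_ac)
  ultimately show ?thesis
    by simp
qed

section \<open>Matching both sides in one dimension\<close>

lemma ito_hermite_eq_hermite_wigner1:
  "ito_hermite m n (\<zeta> / of_real (sqrt 2)) =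
     (-1) ^ n / (of_real (sqrt 2) ^ (m + n) * of_real (sqrt pi))
       * of_real (exp ((cmod \<zeta>)\<^sup>2 / 4)) * hermite_wigner1 m n (Re \<zeta>) (Im \<zeta>)"
proof (induction m arbitrary: n)
  case 0
  show ?case
  proof (induction n)
    case 0
    have "exp ((cmod \<zeta>)\<^sup>2 / 4) * (exp (- ((Re \<zeta>)\<^sup>2 / 4)) * exp (- ((Im \<zeta>)\<^sup>2 / 4))) = 1"
      by (simp add: cmod_power2 field_simps flip: exp_add)
    then show ?case
      by (simp add: hermite_wigner1_def gauss_fourier_1 pcompose_1 flip: of_real_mult)
  next
    case (Suc n)
    then show ?case
      by (simp add: hermite_wigner1_0_Suc divide_simps)
  qed
next
  case (Suc m)
  have s: "complex_of_real (sqrt 2) * of_real (sqrt 2) = 2"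
    by (simp flip: of_real_mult)
  \<comment> \<open>Here \<open>W\<close> and \<open>W'\<close> stand for the transforms at
    \<open>n\<close> and \<open>n - 1\<close>. Lowering \<open>n\<close> flips the sign, and the
    denominators differ by \<open>sqrt 2\<close> squared, so \<open>- n\<close> becomes
    \<open>+ 2 * n\<close>; for \<open>n = 0\<close> both terms vanish.\<close>
  have "(\<zeta> / of_real (sqrt 2)) * ((-1) ^ n / (of_real (sqrt 2) ^ (m + n) * of_real (sqrt pi))
       * of_real (exp ((cmod \<zeta>)\<^sup>2 / 4)) * W)
     - of_nat n * ((-1) ^ (n - 1) / (of_real (sqrt 2) ^ (m + (n - 1)) * of_real (sqrt pi))
       * of_real (exp ((cmod \<zeta>)\<^sup>2 / 4)) * W') =
     (-1) ^ n / (of_real (sqrt 2) ^ (Suc m + n) * of_real (sqrt pi))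
       * of_real (exp ((cmod \<zeta>)\<^sup>2 / 4)) * (\<zeta> * W + 2 * of_nat n * W')" for W W'
  proof (cases n)
    case (Suc k)
    then show ?thesis
      by (simp add: divide_simps s[symmetric]) (simp add: algebra_simps)
  qed (simp add: mult_ac)
  then show ?case
    by (simp only: ito_hermite.simps Suc hermite_wigner1_Suc complex_eq[symmetric])
qed

section \<open>Factorisation of the two-dimensional transform and conclusion\<close>

lemma lborel_integral_mult_prod:
  fixes f g :: "real \<Rightarrow> complex"
  assumes "integrable lborel f" "integrable lborel g"
  shows "(LINT y|lborel. f (fst y) * g (snd y)) = (LINT x|lborel. f x) * (LINT x|lborel. g x)"
proof -
  have [measurable]: "f \<in> borel_measurable lborel" "g \<in> borel_measurable lborel"
    using assms by auto
  have "integrable (lborel \<Otimes>\<^sub>M lborel) (\<lambda>y. f (fst y) * g (snd y))"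
    by (rule lborel_pair.Fubini_integrable) (use assms in \<open>auto simp: norm_mult\<close>)
  from lborel_pair.integral_fst'[OF this] show ?thesis
    by (simp add: lborel_prod)
qed

lemma hermite_wigner_eq:
  "hermite_wigner m n m' n' a b =
     hermite_wigner1 m n (Re a) (Im a) * hermite_wigner1 m' n' (Re b) (Im b) / (2 * of_real pi)"
proof -
  define F where "F m n p q y = gauss_wave q y * poly (pcompose (hermite_poly m) [:of_real (p / 2), 1:] *
      pcompose (hermite_poly n) [:- of_real (p / 2), 1:]) (of_real y)" for m n p q y
  have int: "integrable lborel (F m n p q)" for m n p q
    unfolding F_def by (rule integrable_gauss_wave)
  have F: "exp (\<i> * of_real (y * q)) * of_real (real_hermite m (y + p / 2)) * of_real (real_hermite n (y - p / 2)) =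
      of_real (exp (- (p\<^sup>2 / 4))) * F m n p q y" for m n p q y
  proof -
    \<comment> \<open>Uses \<open>(y + p/2)^2 + (y - p/2)^2 = 2 * y^2 + p^2 / 2\<close>.\<close>
    have "exp (\<i> * of_real (y * q)) * of_real (exp (- ((y + p / 2)\<^sup>2 / 2))) * of_real (exp (- ((y - p / 2)\<^sup>2 / 2))) =
       of_real (exp (- (p\<^sup>2 / 4))) * gauss_wave q y"
      unfolding gauss_wave_def exp_of_real[symmetric] exp_add[symmetric]
      by (rule arg_cong[of _ _ exp]) (simp add: power2_eq_square field_simps)
    moreover have "poly (hermite_poly m) (of_real y + of_real p / 2) = complex_of_real (poly (hermite_poly m) (y + p / 2))"
      using poly_hermite_poly_of_real[of m "y + p / 2"] by simp
    moreover have "poly (hermite_poly n) (of_real y - of_real p / 2) = complex_of_real (poly (hermite_poly n) (y - p / 2))"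
      using poly_hermite_poly_of_real[of n "y - p / 2"] by simp
    ultimately show ?thesis
      unfolding real_hermite_eq F_def
      by (simp add: poly_pcompose add.commute mult.assoc)
  qed
  let ?F = "\<lambda>y. of_real (exp (- ((Re a)\<^sup>2 / 4))) * F m n (Re a) (Im a) (fst y)
     * (of_real (exp (- ((Re b)\<^sup>2 / 4))) * F m' n' (Re b) (Im b) (snd y))"
  have "hermite_wigner m n m' n' a b = 1 / (2 * of_real pi) * (LINT y|lebesgue. ?F y)"
    unfolding hermite_wigner_def fourier_wigner2_def F[symmetric]
    by (intro arg_cong[of _ _ "(*) (1 / (2 * of_real pi))"] Bochner_Integration.integral_cong refl)
       (simp add: tensor_def case_prod_unfold inner_prod_def algebra_simps flip: exp_add)
  \<comment> \<open>Fubini is applied over \<open>lborel\<close>; Borel measurability of the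
    integrand permits leaving the completed measure.\<close>
  also have "(LINT y|lebesgue. ?F y) = (LINT y|lborel. ?F y)"
  proof (rule integral_completion)
    have [measurable]: "F m n p q \<in> borel_measurable borel" for m n p q
      using int[of m n p q] by (auto dest: borel_measurable_integrable)
    show "?F \<in> borel_measurable lborel"
      unfolding lborel_prod[symmetric] by measurable
  qed
  also have "\<dots> = hermite_wigner1 m n (Re a) (Im a) * hermite_wigner1 m' n' (Re b) (Im b)"
    unfolding hermite_wigner1_def gauss_fourier_def F_def[symmetric]
    by (subst lborel_integral_mult_prod) (auto intro: int)
  finally show ?thesis by simp
qed

theorem theorem3p22:
  fixes m n m' n' :: nat and z w :: complex
  shows "complex_hermite2 m n m' n' (z / of_real (sqrt 2)) (w / of_real (sqrt 2)) =
     (-1) ^ (n + n') / of_real (sqrt 2) powi (int (m + n + m' + n') - 2)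
       * exp (of_real (((cmod z)\<^sup>2 + (cmod w)\<^sup>2) / 2))
       * hermite_wigner m n m' n' (z + \<i> * w) (cnj z + \<i> * cnj w)"
proof -
  let ?a = "z + \<i> * w" and ?b = "cnj z + \<i> * cnj w"
  let ?s = "complex_of_real (sqrt 2)"
  have args: "z / ?s + \<i> * (w / ?s) = ?a / ?s" "cnj (z / ?s) + \<i> * cnj (w / ?s) = ?b / ?s"
    by (simp_all add: add_divide_distrib)
  \<comment> \<open>The cross terms of the two squared moduli have opposite signs and
    cancel.\<close>
  have "(cmod ?a)\<^sup>2 / 4 + (cmod ?b)\<^sup>2 / 4 = ((cmod z)\<^sup>2 + (cmod w)\<^sup>2) / 2"
    by (simp add: cmod_power2) (simp add: power2_eq_square field_simps)
  then have exp: "exp (of_real (((cmod z)\<^sup>2 + (cmod w)\<^sup>2) / 2)) =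
      complex_of_real (exp ((cmod ?a)\<^sup>2 / 4)) * of_real (exp ((cmod ?b)\<^sup>2 / 4))"
    by (simp only: exp_of_real flip: exp_add of_real_add of_real_mult)
  \<comment> \<open>The exponent can be negative, hence an integer power. The 2 split off here
    offsets the 2 in the normalisation \<open>1 / (2 * pi)\<close>; the two factors
    \<open>sqrt pi\<close> supply the rest.\<close>
  have powi: "?s powi (int (m + n + m' + n') - 2) = ?s ^ (m + n) * ?s ^ (m' + n') / 2"
    by (subst power_int_diff) (simp_all add: power_add power_int_add flip: of_real_power)
  have "complex_of_real (sqrt pi) * of_real (sqrt pi) = of_real pi"
    by (simp flip: of_real_mult)
  then show ?thesis
    unfolding complex_hermite2_def complex_hermite_eq args ito_hermite_eq_hermite_wigner1
      hermite_wigner_eq exp powi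
    by (simp add: power_add field_simps)
qed

end
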